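(* Let $W$ be a nonempty set of nonempty linear words. Then $$\operatorname{Var}(S(W))=\begin{cases}\operatorname{Var}(A_m), & \text{if the lengths of words in } W \text{ are bounded and } m=\max\{|w|:w\in W\},\\ \operatorname{Var}(A_\infty), & \text{if } \{|w|:w\in W\}\text{ is unbounded.}\end{cases}$$
   Context: For an alphabet $X$, $X^+$ is the free semigroup on $X$ (all nonempty finite words); $|w|$ is the length of $w$. For a nonempty set $W\subseteq X^+$, $F(W)$ is the set of all nonempty contiguous factors of words in $W$. The algebra $S(W)=(F(W)\cup\{0\},+,\cdot)$ has flat addition ($x+x=x$, and $x+y=0$ whenever $x\ne y$) and multiplication: for $u,v\in F(W)$, $u\cdot v$ is the concatenation $uv$ if $uv\in F(W)$ and $0$ otherwise; products involving $0$ are $0$. A word is linear if no letter occurs in it more than once. For $m\ge 1$, $A_m=S(\{a_1\cdots a_m\})$ with $a_1,\dots,a_m$ distinct letters; equivalently $A_m=\{0\}\cup\{[i,j]:0\le i<j\le m\}$ with flat addition and $[i,j][k,l]=[i,l]$ if $j=k$, $[i,j][k,l]=0$ if $j\neq k$, and all products with $0$ equal to $0$. $A_\infty$ is defined by the same operations on $\{0\}\cup\{[i,j]: i,j\in\mathbb N_0,\ i<j\}$, where $\mathbb N_0$ is the set of nonnegative integers. $\operatorname{Var}(S)$ is the variety generated by the algebra $S$ in the signature $(+,\cdot)$. *)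

theory Defs
  imports Main "HOL-Library.FuncSet" "HOL-Library.Sublist"
begin

section \<open>Algebras in the signature $(+,\cdot)$\<close>

record 'a alg =
  carrier :: "'a set"
  add :: "'a \<Rightarrow> 'a \<Rightarrow> 'a"
  mult :: "'a \<Rightarrow> 'a \<Rightarrow> 'a"

text \<open>The values of the operations outside the carrier are irrelevant. As usual, carriers
  are nonempty.\<close>

definition algebra :: "'a alg \<Rightarrow> bool" where
  "algebra A \<longleftrightarrow> carrier A \<noteq> {} \<and>
     (\<forall>x\<in>carrier A. \<forall>y\<in>carrier A. add A x y \<in> carrier A \<and> mult A x y \<in> carrier A)"

definition subalgebra :: "'a alg \<Rightarrow> 'a alg \<Rightarrow> bool" where
  "subalgebra C D \<longleftrightarrow> algebra C \<and> carrier C \<subseteq> carrier D \<and>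
     (\<forall>x\<in>carrier C. \<forall>y\<in>carrier C. add C x y = add D x y \<and> mult C x y = mult D x y)"

definition hom :: "'a alg \<Rightarrow> 'b alg \<Rightarrow> ('a \<Rightarrow> 'b) set" where
  "hom C B = {h. h ` carrier C \<subseteq> carrier B \<and>
     (\<forall>x\<in>carrier C. \<forall>y\<in>carrier C.
        h (add C x y) = add B (h x) (h y) \<and> h (mult C x y) = mult B (h x) (h y))}"

definition power_alg :: "'a alg \<Rightarrow> 'i set \<Rightarrow> ('i \<Rightarrow> 'a) alg" where
  "power_alg A I = \<lparr>carrier = (\<Pi>\<^sub>E i\<in>I. carrier A),
     add = (\<lambda>f g. \<lambda>i\<in>I. add A (f i) (g i)),
     mult = (\<lambda>f g. \<lambda>i\<in>I. mult A (f i) (g i))\<rparr>"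

text \<open>\<open>HSP_image I A B\<close>: the algebra \<open>B\<close> is a homomorphic image of a subalgebra of the
  direct power of \<open>A\<close> with index set \<open>I\<close>.\<close>

definition HSP_image :: "'i set \<Rightarrow> 'a alg \<Rightarrow> 'b alg \<Rightarrow> bool" where
  "HSP_image I A B \<longleftrightarrow> algebra B \<and>
     (\<exists>C h. subalgebra C (power_alg A I) \<and> h \<in> hom C B \<and> h ` carrier C = carrier B)"

text \<open>The variety generated by \<open>A\<close> is the class \<open>HSP(A)\<close>; since HOL has no proper classes, it is
  given by its members on each type \<open>'b\<close>. A definition cannot quantify over the type of the
  index set, but index sets of valuations \<open>'b \<Rightarrow> 'a\<close> suffice for algebras on \<open>'b\<close>: the free
  algebra of the variety over the set \<open>B\<close> embeds into the power of \<open>A\<close> with exponent \<open>A\<^sup>B\<close>.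
  Lemma \<open>HSP_image_in_Var\<close> shows that nothing is lost by this choice, and lemma
  \<open>Var_iff_identities\<close> that \<open>Var A\<close> consists of the models of the identities of \<open>A\<close>.\<close>

definition Var :: "'a alg \<Rightarrow> 'b alg set" where
  "Var A = {B. \<exists>I :: ('b \<Rightarrow> 'a) set. HSP_image I A B}"


section \<open>Identities and the generated variety\<close>

datatype 'v tm = Vr 'v | Add "'v tm" "'v tm" | Mul "'v tm" "'v tm"

primrec eval_tm :: "'a alg \<Rightarrow> ('v \<Rightarrow> 'a) \<Rightarrow> 'v tm \<Rightarrow> 'a" where
  "eval_tm A e (Vr x) = e x"
| "eval_tm A e (Add s t) = add A (eval_tm A e s) (eval_tm A e t)"
| "eval_tm A e (Mul s t) = mult A (eval_tm A e s) (eval_tm A e t)"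

definition holds :: "'a alg \<Rightarrow> 'v tm \<Rightarrow> 'v tm \<Rightarrow> bool" where
  "holds A s t \<longleftrightarrow> (\<forall>e. range e \<subseteq> carrier A \<longrightarrow> eval_tm A e s = eval_tm A e t)"

lemma eval_tm_closed:
  assumes "algebra A" "range e \<subseteq> carrier A"
  shows "eval_tm A e t \<in> carrier A"
  using assms by (induction t) (auto simp: algebra_def)

lemma eval_tm_map: "eval_tm A e (map_tm f t) = eval_tm A (e \<circ> f) t"
  by (induction t) auto

lemma eval_tm_cong:
  "(\<And>x. x \<in> set_tm t \<Longrightarrow> e x = e' x) \<Longrightarrow> eval_tm A e t = eval_tm A e' t"
  by (induction t) auto

lemma finite_set_tm: "finite (set_tm t)"
  by (induction t) auto

lemma holds_rename:
  fixes s t :: "'v tm" and A :: "'a alg" and B :: "'b alg"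
  assumes "\<And>s t :: nat tm. holds A s t \<Longrightarrow> holds B s t" and "holds A s t"
  shows "holds B s t"
  unfolding holds_def
proof (intro allI impI)
  fix e :: "'v \<Rightarrow> 'b" assume e: "range e \<subseteq> carrier B"
  let ?V = "set_tm s \<union> set_tm t"
  have "finite ?V" by (simp add: finite_set_tm)
  then obtain f :: "'v \<Rightarrow> nat" where f: "inj_on f ?V"
    using finite_imp_inj_to_nat_seg by blast
  have "holds A (map_tm f s) (map_tm f t)"
    unfolding holds_def eval_tm_map
  proof (intro allI impI)
    fix d :: "nat \<Rightarrow> 'a" assume "range d \<subseteq> carrier A"
    then have "range (d \<circ> f) \<subseteq> carrier A" by auto
    then show "eval_tm A (d \<circ> f) s = eval_tm A (d \<circ> f) t"
      using assms(2) by (simp add: holds_def)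
  qed
  then have B: "holds B (map_tm f s) (map_tm f t)" by (rule assms(1))
  let ?d = "e \<circ> inv_into ?V f"
  have "range ?d \<subseteq> carrier B" using e by auto
  then have eq: "eval_tm B (?d \<circ> f) s = eval_tm B (?d \<circ> f) t"
    using B unfolding holds_def eval_tm_map by blast
  have *: "(?d \<circ> f) x = e x" if "x \<in> ?V" for x using f that by simp
  have "eval_tm B (?d \<circ> f) s = eval_tm B e s" by (rule eval_tm_cong, rule *) simp
  moreover have "eval_tm B (?d \<circ> f) t = eval_tm B e t" by (rule eval_tm_cong, rule *) simp
  ultimately show "eval_tm B e s = eval_tm B e t" using eq by simp
qed

lemma HSP_image_holds:
  fixes s t :: "'v tm" and A :: "'a alg" and B :: "'b alg"
  assumes "HSP_image I A B" and st: "holds A s t"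
  shows "holds B s t"
  unfolding holds_def
proof (intro allI impI)
  fix e :: "'v \<Rightarrow> 'b" assume e: "range e \<subseteq> carrier B"
  from assms(1) obtain C h where C: "subalgebra C (power_alg A I)" and h: "h \<in> hom C B"
    and sur: "h ` carrier C = carrier B"
    unfolding HSP_image_def by blast
  have algC: "algebra C" using C by (simp add: subalgebra_def)
  let ?d = "\<lambda>v. inv_into (carrier C) h (e v)"
  have inC: "inv_into (carrier C) h (e v) \<in> carrier C" for v
    by (rule inv_into_into) (use e sur in auto)
  have d: "range ?d \<subseteq> carrier C"
    using inC by auto
  have hd: "h (?d v) = e v" for v
    using e sur by (simp add: f_inv_into_f range_subsetD)
  have clC: "eval_tm C ?d t \<in> carrier C" for t
    by (rule eval_tm_closed[OF algC d])
  have he: "h (eval_tm C ?d u) = eval_tm B e u" for u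
    using h by (induction u) (simp_all add: hd hom_def clC)
  have ext: "c \<in> extensional I" if "c \<in> carrier C" for c
    using C that by (auto simp: subalgebra_def power_alg_def PiE_def)
  have pt: "eval_tm C ?d u i = eval_tm A (\<lambda>v. ?d v i) u" if "i \<in> I" for i u
  proof (induction u)
    case (Add u1 u2)
    have "add C (eval_tm C ?d u1) (eval_tm C ?d u2) =
        add (power_alg A I) (eval_tm C ?d u1) (eval_tm C ?d u2)"
      using C clC by (simp add: subalgebra_def)
    then show ?case using Add that by (simp add: power_alg_def)
  next
    case (Mul u1 u2)
    have "mult C (eval_tm C ?d u1) (eval_tm C ?d u2) =
        mult (power_alg A I) (eval_tm C ?d u1) (eval_tm C ?d u2)"
      using C clC by (simp add: subalgebra_def)
    then show ?case using Mul that by (simp add: power_alg_def)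
  qed simp
  have "eval_tm C ?d s = eval_tm C ?d t"
  proof (rule extensionalityI[OF ext[OF clC] ext[OF clC]])
    fix i assume i: "i \<in> I"
    have "?d v i \<in> carrier A" for v
      using C inC[of v] i by (auto simp: subalgebra_def power_alg_def)
    then have "range (\<lambda>v. ?d v i) \<subseteq> carrier A" by blast
    then show "eval_tm C ?d s i = eval_tm C ?d t i"
      using st pt[OF i] by (simp add: holds_def)
  qed
  then show "eval_tm B e s = eval_tm B e t" by (metis he)
qed

lemma models_in_Var:
  fixes A :: "'a alg" and B :: "'b alg"
  assumes A: "algebra A" and B: "algebra B"
    and AB: "\<And>s t :: 'b tm. holds A s t \<Longrightarrow> holds B s t"
  shows "B \<in> Var A"
proof -
  define I :: "('b \<Rightarrow> 'a) set" where "I = {e. range e \<subseteq> carrier A}"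
  define ev where "ev t = (\<lambda>e\<in>I. eval_tm A e t)" for t :: "'b tm"
  define C where "C = \<lparr>carrier = range ev, add = add (power_alg A I), mult = mult (power_alg A I)\<rparr>"
  obtain b where b: "b \<in> carrier B" using B by (auto simp: algebra_def)
  define r where "r x = (if x \<in> carrier B then x else b)" for x
  have r: "range r \<subseteq> carrier B" using b by (auto simp: r_def)
  define h where "h c = eval_tm B r (SOME t. ev t = c)" for c
  have h: "h (ev t) = eval_tm B r t" for t
  proof -
    have some: "ev (SOME u. ev u = ev t) = ev t" by (rule someI) (rule refl)
    have "eval_tm B r s = eval_tm B r u" if "ev s = ev u" for s u
    proof -
      have "eval_tm A e s = eval_tm A e u" if "e \<in> I" for e
        using fun_cong[OF \<open>ev s = ev u\<close>, of e] that by (simp add: ev_def)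
      then have "holds A s u" by (simp add: holds_def I_def)
      then have "holds B s u" by (rule AB)
      then show ?thesis using r unfolding holds_def by blast
    qed
    from this[OF some] show ?thesis by (simp only: h_def)
  qed
  have ops: "add (power_alg A I) (ev s) (ev t) = ev (Add s t)"
    "mult (power_alg A I) (ev s) (ev t) = ev (Mul s t)" for s t
    by (auto simp: power_alg_def ev_def)
  have "ev t \<in> carrier (power_alg A I)" for t
    using eval_tm_closed[OF A] by (auto simp: power_alg_def ev_def I_def)
  then have "subalgebra C (power_alg A I)"
    by (auto simp: subalgebra_def algebra_def C_def ops)
  moreover have "h \<in> hom C B"
    by (auto simp: hom_def C_def ops h eval_tm_closed[OF B r])
  moreover have "h ` carrier C = carrier B"
  proof
    show "h ` carrier C \<subseteq> carrier B" by (auto simp: C_def h eval_tm_closed[OF B r])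
    show "carrier B \<subseteq> h ` carrier C"
    proof
      fix x assume "x \<in> carrier B"
      then have "x = h (ev (Vr x))" by (simp add: h r_def)
      then show "x \<in> h ` carrier C" by (simp add: C_def)
    qed
  qed
  ultimately have "HSP_image I A B" using B by (auto simp: HSP_image_def)
  then show ?thesis by (auto simp: Var_def)
qed

lemma HSP_image_in_Var:
  fixes I :: "'i set" and A :: "'a alg" and B :: "'b alg"
  assumes "algebra A" "HSP_image I A B"
  shows "B \<in> Var A"
proof (rule models_in_Var)
  show "algebra A" by (fact assms(1))
  show "algebra B" using assms(2) by (simp add: HSP_image_def)
  show "holds B s t" if "holds A s t" for s t :: "'b tm"
    using assms(2) that by (rule HSP_image_holds)
qed

lemma Var_iff_identities:
  fixes A :: "'a alg" and B :: "'b alg"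
  assumes "algebra A"
  shows "B \<in> Var A \<longleftrightarrow> algebra B \<and> (\<forall>s t :: nat tm. holds A s t \<longrightarrow> holds B s t)"
proof
  assume "B \<in> Var A"
  then obtain I :: "('b \<Rightarrow> 'a) set" where I: "HSP_image I A B" unfolding Var_def by blast
  then have "algebra B" by (simp add: HSP_image_def)
  then show "algebra B \<and> (\<forall>s t :: nat tm. holds A s t \<longrightarrow> holds B s t)"
    using HSP_image_holds[OF I] by blast
next
  assume *: "algebra B \<and> (\<forall>s t :: nat tm. holds A s t \<longrightarrow> holds B s t)"
  show "B \<in> Var A"
  proof (rule models_in_Var[OF assms])
    show "algebra B" using * by blast
    show "holds B s t" if "holds A s t" for s t :: "'b tm"
    proof (rule holds_rename[OF _ that])
      fix s t :: "nat tm" assume "holds A s t"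
      then show "holds B s t" using * by blast
    qed
  qed
qed


section \<open>The algebras $S(W)$, $A_m$ and $A_\infty$\<close>

definition factors :: "'x list set \<Rightarrow> 'x list set" where
  "factors W = {u. u \<noteq> [] \<and> (\<exists>w\<in>W. sublist u w)}"

text \<open>The zero element is \<open>None\<close>.\<close>

definition flat_add :: "'a option \<Rightarrow> 'a option \<Rightarrow> 'a option" where
  "flat_add x y = (if x = y then x else None)"

definition word_mult :: "'x list set \<Rightarrow> 'x list option \<Rightarrow> 'x list option \<Rightarrow> 'x list option" where
  "word_mult W x y = (case (x, y) of
     (Some u, Some v) \<Rightarrow> (if u @ v \<in> factors W then Some (u @ v) else None)
   | _ \<Rightarrow> None)"

definition S_alg :: "'x list set \<Rightarrow> 'x list option alg" where
  "S_alg W = \<lparr>carrier = insert None (Some ` factors W), add = flat_add, mult = word_mult W\<rparr>"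

text \<open>The letters \<open>a\<^sub>1, \<dots>, a\<^sub>m\<close> are the numbers \<open>1, \<dots>, m\<close>.\<close>

definition A_alg :: "nat \<Rightarrow> nat list option alg" where
  "A_alg m = S_alg {[1..<Suc m]}"

definition interval_mult :: "(nat \<times> nat) option \<Rightarrow> (nat \<times> nat) option \<Rightarrow> (nat \<times> nat) option" where
  "interval_mult x y = (case (x, y) of
     (Some (i, j), Some (k, l)) \<Rightarrow> (if j = k then Some (i, l) else None)
   | _ \<Rightarrow> None)"

definition A_inf :: "(nat \<times> nat) option alg" where
  "A_inf = \<lparr>carrier = insert None (Some ` {(i, j). i < j}), add = flat_add, mult = interval_mult\<rparr>"

end

(* Sending the words outside F(V) to 0 is a homomorphism from S(W) onto S(V) whenever
   F(V) is contained in F(W). Two distinct elements of S(W), one of which is a word u, stay distinct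
   under the collapse to S({w}) for any w in W having u as a factor. Hence S(W) satisfies exactly
   the identities common to all S({w}), w in W, and S({w}) is a copy of A_|w| because w is linear.
   A_infinity is a copy of S(W) for W consisting of all words 1 2 ... m, so it satisfies the
   identities common to all A_m; and the identities of A_m hold in A_k for k at most m. *)

theory Submission
  imports Defs
begin

section \<open>Transfer of identities along homomorphisms\<close>

lemma eval_tm_hom:
  assumes "algebra A" "h \<in> hom A B" "range e \<subseteq> carrier A"
  shows "eval_tm B (h \<circ> e) t = h (eval_tm A e t)"
  using assms(2) eval_tm_closed[OF assms(1,3)] by (induction t) (simp_all add: hom_def)

text \<open>Every valuation in \<open>B\<close> lifts to one in \<open>A\<close> by choosing
  preimages; \<open>h\<close> then carries the equality of the two values back to
  \<open>B\<close>.\<close>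

lemma holds_surj_hom:
  fixes s t :: "'v tm" and A :: "'a alg" and B :: "'b alg"
  assumes A: "algebra A" and h: "h \<in> hom A B" and surj: "carrier B \<subseteq> h ` carrier A"
    and st: "holds A s t"
  shows "holds B s t"
  unfolding holds_def
proof (intro allI impI)
  fix e :: "'v \<Rightarrow> 'b" assume "range e \<subseteq> carrier B"
  with surj have "\<forall>v. \<exists>a\<in>carrier A. e v = h a" by blast
  then obtain d where d: "\<And>v. d v \<in> carrier A" "\<And>v. e v = h (d v)" by metis
  then have e: "e = h \<circ> d" and dA: "range d \<subseteq> carrier A" by auto
  with st show "eval_tm B e s = eval_tm B e t"
    by (simp add: e eval_tm_hom[OF A h dA] holds_def)
qed

text \<open>A valuation in \<open>A\<close> is pushed forward to \<open>B\<close>, where the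
  identity applies, and injectivity cancels \<open>h\<close> from the resulting equality.\<close>

lemma holds_inj_hom:
  fixes s t :: "'v tm" and A :: "'a alg" and B :: "'b alg"
  assumes A: "algebra A" and h: "h \<in> hom A B" and inj: "inj_on h (carrier A)"
    and st: "holds B s t"
  shows "holds A s t"
  unfolding holds_def
proof (intro allI impI)
  fix e :: "'v \<Rightarrow> 'a" assume e: "range e \<subseteq> carrier A"
  then have "range (h \<circ> e) \<subseteq> carrier B" using h by (auto simp: hom_def)
  with st have "h (eval_tm A e s) = h (eval_tm A e t)"
    by (simp add: holds_def flip: eval_tm_hom[OF A h e])
  then show "eval_tm A e s = eval_tm A e t"
    using inj eval_tm_closed[OF A e] by (auto dest: inj_onD)
qed

lemma holds_iso:
  assumes "algebra A" "h \<in> hom A B" "bij_betw h (carrier A) (carrier B)"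
  shows "holds A s t \<longleftrightarrow> holds B s t"
  using holds_surj_hom[OF assms(1,2)] holds_inj_hom[OF assms(1,2)] assms(3)
  by (auto simp: bij_betw_def)

lemma Var_eqI:
  fixes A :: "'a alg" and B :: "'b alg"
  assumes "algebra A" "algebra B" "\<And>s t :: nat tm. holds A s t \<longleftrightarrow> holds B s t"
  shows "Var A = (Var B :: 'c alg set)"
  using assms by (auto simp: Var_iff_identities)

section \<open>Reduction of the identities of S(W) to those of single words\<close>

lemma algebra_S_alg: "algebra (S_alg W)"
  by (auto simp: algebra_def S_alg_def flat_add_def word_mult_def split: option.splits)

lemma algebra_A_inf: "algebra A_inf"
  by (auto simp: algebra_def A_inf_def flat_add_def interval_mult_def split: option.splits)

lemma factors_append:
  assumes "u @ v \<in> factors W" "u \<noteq> []" "v \<noteq> []"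
  shows "u \<in> factors W" "v \<in> factors W"
  using assms sublist_order.order.trans[of u "u @ v"] sublist_order.order.trans[of v "u @ v"]
  by (auto simp: factors_def)

lemma factors_not_Nil: "u \<in> factors W \<Longrightarrow> u \<noteq> []"
  by (simp add: factors_def)

definition collapse :: "'x list set \<Rightarrow> 'x list option \<Rightarrow> 'x list option" where
  "collapse V x = (if x \<in> Some ` factors V then x else None)"

text \<open>Since \<open>factors V\<close> is closed under nonempty factors, a product is sent to
  \<open>None\<close> as soon as one of its arguments is. Sums are respected because distinct
  elements can only be identified at \<open>None\<close>, which is also their sum.\<close>

lemma collapse_hom:
  assumes sub: "factors V \<subseteq> factors W"
  shows "collapse V \<in> hom (S_alg W) (S_alg V)"
proof -
  have append: "u @ v \<in> factors V \<longleftrightarrow> u \<in> factors V \<and> v \<in> factors V \<and> u @ v \<in> factors V"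
    if "u \<in> factors W" "v \<in> factors W" for u v
    using factors_append[of u v V] that by (auto simp: factors_not_Nil)
  have "collapse V (word_mult W (Some u) (Some v)) =
      word_mult V (collapse V (Some u)) (collapse V (Some v))"
    if "u \<in> factors W" "v \<in> factors W" for u v
    using append[OF that] subsetD[OF sub, of "u @ v"] by (simp add: collapse_def word_mult_def) blast
  then show ?thesis
    by (auto simp: hom_def S_alg_def) (auto simp: collapse_def flat_add_def word_mult_def)
qed

lemma holds_S_alg_mono:
  assumes "factors V \<subseteq> factors W" "holds (S_alg W) s t"
  shows "holds (S_alg V) s t"
proof (rule holds_surj_hom[OF algebra_S_alg collapse_hom[OF assms(1)] _ assms(2)])
  show "carrier (S_alg V) \<subseteq> collapse V ` carrier (S_alg W)"
    using assms(1) by (force simp: S_alg_def collapse_def image_iff)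
qed

lemma holds_S_alg_iff:
  fixes s t :: "'v tm" and W :: "'x list set"
  shows
  "holds (S_alg W) s t \<longleftrightarrow> (\<forall>w\<in>W. holds (S_alg {w}) s t)"
proof
  assume "holds (S_alg W) s t"
  then show "\<forall>w\<in>W. holds (S_alg {w}) s t"
    by (auto intro!: holds_S_alg_mono[of _ W] simp: factors_def)
next
  assume *: "\<forall>w\<in>W. holds (S_alg {w}) s t"
  show "holds (S_alg W) s t"
    unfolding holds_def
  proof (intro allI impI)
    fix e :: "'v \<Rightarrow> 'x list option" assume e: "range e \<subseteq> carrier (S_alg W)"
    \<comment> \<open>Here \<open>p\<close> and \<open>q\<close> are \<open>s\<close> and
      \<open>t\<close> in either order: a nonzero value of one side forces the same value on the
      other.\<close>
    have eq: "eval_tm (S_alg W) e q = Some u"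
      if p: "eval_tm (S_alg W) e p = Some u" and pq: "{p, q} = {s, t}" for p q u
    proof -
      have "Some u \<in> carrier (S_alg W)"
        using eval_tm_closed[OF algebra_S_alg e, of p] p by simp
      then obtain w where w: "w \<in> W" "u \<in> factors {w}"
        by (auto simp: S_alg_def factors_def)
      then have h: "collapse {w} \<in> hom (S_alg W) (S_alg {w})"
        by (intro collapse_hom) (auto simp: factors_def)
      have "range (collapse {w} \<circ> e) \<subseteq> carrier (S_alg {w})"
        using e h by (auto simp: hom_def)
      moreover have "holds (S_alg {w}) s t" using * w by blast
      ultimately have "collapse {w} (eval_tm (S_alg W) e p) = collapse {w} (eval_tm (S_alg W) e q)"
        using pq by (auto simp: holds_def doubleton_eq_iff simp flip: eval_tm_hom[OF algebra_S_alg h e])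
      \<comment> \<open>As \<open>u\<close> is a factor of \<open>w\<close>, the collapse fixes
        \<open>Some u\<close>, and no other element is sent to it.\<close>
      then show ?thesis using p w by (auto simp: collapse_def split: if_splits)
    qed
    show "eval_tm (S_alg W) e s = eval_tm (S_alg W) e t"
      \<comment> \<open>Only the case of two zero values is not covered by \<open>eq\<close>, and it
        is trivial.\<close>
      using eq[of s _ t] eq[of t _ s]
      by (cases "eval_tm (S_alg W) e s"; cases "eval_tm (S_alg W) e t") auto
  qed
qed

section \<open>Linear words and the algebras A_m\<close>

lemma factors_map: "factors {map f w} = map f ` factors {w}"
  by (auto simp: factors_def image_iff intro: map_mono_sublist dest: sublist_map_rightE)

lemma inj_on_map_lists:
  assumes "inj_on f (set w)"
  shows "inj_on (map f) {u. set u \<subseteq> set w}"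
proof (rule inj_onI)
  fix u v assume "u \<in> {u. set u \<subseteq> set w}" "v \<in> {u. set u \<subseteq> set w}" and eq: "map f u = map f v"
  then have "set u \<union> set v \<subseteq> set w" by simp
  then show "u = v" by (rule map_inj_on[OF eq inj_on_subset[OF assms]])
qed

text \<open>Factors of \<open>w\<close> and their concatenations use only letters of
  \<open>w\<close>, so injectivity on these letters already makes renaming an isomorphism.\<close>

lemma holds_S_alg_map:
  assumes f: "inj_on f (set w)"
  shows "holds (S_alg {map f w}) s t \<longleftrightarrow> holds (S_alg {w}) s t"
proof -
  let ?h = "map_option (map f)"
  have set: "set u \<subseteq> set w" if "u \<in> factors {w}" for u
    using that by (auto simp: factors_def dest: set_mono_sublist)
  have inj: "map f u = map f v \<longleftrightarrow> u = v" if "set u \<subseteq> set w" "set v \<subseteq> set w" for u v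
    using inj_on_eq_iff[OF inj_on_map_lists[OF f]] that by simp
  have factor: "map f u @ map f v \<in> map f ` factors {w} \<longleftrightarrow> u @ v \<in> factors {w}"
    if "u \<in> factors {w}" "v \<in> factors {w}" for u v
  proof
    assume "map f u @ map f v \<in> map f ` factors {w}"
    then obtain x where "map f (u @ v) = map f x" "x \<in> factors {w}"
      by auto
    moreover from this have "u @ v = x"
      using set[OF that(1)] set[OF that(2)] set[of x] inj[of "u @ v" x] by simp
    ultimately show "u @ v \<in> factors {w}" by simp
  qed (simp flip: map_append)
  have "?h \<in> hom (S_alg {w}) (S_alg {map f w})"
    by (auto simp: hom_def S_alg_def flat_add_def word_mult_def factor factors_map inj set)
  moreover have "bij_betw ?h (carrier (S_alg {w})) (carrier (S_alg {map f w}))"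
    by (auto simp: bij_betw_def inj_on_def S_alg_def factors_map image_image inj set)
  ultimately show ?thesis using holds_iso[OF algebra_S_alg] by blast
qed

lemma holds_S_alg_distinct:
  assumes "distinct w"
  shows "holds (S_alg {w}) s t \<longleftrightarrow> holds (A_alg (length w)) s t"
proof -
  \<comment> \<open>The shift by one is there because the letters of \<open>A_alg\<close> start at 1
    and list positions at 0. Linearity of \<open>w\<close> makes this numbering injective.\<close>
  let ?f = "\<lambda>i. w ! (i - 1)"
  have "map ?f [1..<Suc (length w)] = w"
    by (rule nth_equalityI) (simp_all del: upt_Suc)
  moreover have "inj_on ?f (set [1..<Suc (length w)])"
    using assms by (auto simp: inj_on_def nth_eq_iff_index_eq)
  ultimately show ?thesis
    using holds_S_alg_map[of ?f "[1..<Suc (length w)]" s t] by (simp add: A_alg_def)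
qed

text \<open>The word defining \<open>A_alg k\<close> is a prefix of the one defining
  \<open>A_alg m\<close>, so the larger algebra collapses onto the smaller.\<close>

lemma holds_A_alg_mono:
  assumes "k \<le> m" "holds (A_alg m) s t"
  shows "holds (A_alg k) s t"
proof -
  have "[1..<Suc m] = [1..<Suc k] @ [Suc k..<Suc m]"
    using assms(1) upt_add_eq_append[of 1 "Suc k" "m - k"] by (simp del: upt_Suc)
  then have "factors {[1..<Suc k]} \<subseteq> factors {[1..<Suc m]}"
    using sublist_order.order.trans[of _ "[1..<Suc k]" "[1..<Suc m]"]
    by (auto simp: factors_def simp del: upt_Suc)
  then show ?thesis
    using assms(2) holds_S_alg_mono unfolding A_alg_def by blast
qed

section \<open>A_infinity as a word algebra\<close>

text \<open>This is the dictionary between the two descriptions: the interval \<open>(i, j)\<close>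
  stands for the word with letters from \<open>Suc i\<close> to \<open>j\<close>, so that adjacent
  intervals share an endpoint.\<close>

lemma factors_intervals:
  "factors (range (\<lambda>m. [1..<Suc m])) = (\<lambda>(i, j). [Suc i..<Suc j]) ` {(i, j). i < j}"
proof (intro subset_antisym subsetI)
  fix u assume "u \<in> factors (range (\<lambda>m. [1..<Suc m]))"
  then obtain m p q where u: "u \<noteq> []" and m: "[1..<Suc m] = p @ u @ q"
    by (auto simp: factors_def sublist_def simp del: upt_Suc)
  have "m = length p + length u + length q"
    using arg_cong[OF m, of length] by (simp del: upt_Suc)
  \<comment> \<open>Cutting \<open>p\<close> and \<open>q\<close> off the word
    \<open>p @ u @ q\<close> leaves \<open>u\<close>; as letters start at 1, the first letter after
    \<open>p\<close> is \<open>Suc (length p)\<close>.\<close>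
  then have "take (length u) (drop (length p) [1..<Suc m]) =
      [Suc (length p)..<Suc (length p + length u)]"
    using take_upt[of "Suc (length p)" "length u" "Suc m"] by (simp add: drop_upt del: upt_Suc)
  then have "u = [Suc (length p)..<Suc (length p + length u)]"
    unfolding m by simp
  then show "u \<in> (\<lambda>(i, j). [Suc i..<Suc j]) ` {(i, j). i < j}"
    using u by (force simp del: upt_Suc)
next
  fix u assume "u \<in> (\<lambda>(i, j). [Suc i..<Suc j]) ` {(i, j). i < j}"
  then obtain i j where u: "u = [Suc i..<Suc j]" "i < j" by auto
  then have "[1..<Suc j] = [1..<Suc i] @ u"
    using upt_add_eq_append[of 1 "Suc i" "j - i"] by (simp del: upt_Suc)
  then have "sublist u [1..<Suc j]" by (simp del: upt_Suc)
  then show "u \<in> factors (range (\<lambda>m. [1..<Suc m]))"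
    using u by (auto simp: factors_def simp del: upt_Suc)
qed

lemma upt_eq_upt_iff:
  assumes "i < j" "k < l"
  shows "[i..<j] = [k..<l] \<longleftrightarrow> i = k \<and> j = l"
proof
  assume eq: "[i..<j] = [k..<l]"
  have "i = k" using arg_cong[OF eq, of hd] assms by simp
  moreover have "j - i = l - k" using arg_cong[OF eq, of length] by simp
  ultimately show "i = k \<and> j = l" using assms by simp
qed simp

lemma holds_A_inf_iff:
  "holds A_inf s t \<longleftrightarrow> (\<forall>m. holds (A_alg m) s t)"
proof -
  \<comment> \<open>For \<open>m = 0\<close> the word is empty and contributes no factor; it
    corresponds to \<open>A_alg 0\<close>, whose only element is zero.\<close>
  define W where "W = range (\<lambda>m. [1..<Suc m])"
  let ?g = "\<lambda>(i, j). [Suc i..<Suc j]"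
  let ?h = "map_option ?g"
  note factors_W = factors_intervals[folded W_def]
  have append: "[Suc i..<Suc j] @ [Suc k..<Suc l] \<in> factors W \<longleftrightarrow> j = k"
    if "i < j" "k < l" for i j k l
  proof
    assume "[Suc i..<Suc j] @ [Suc k..<Suc l] \<in> factors W"
    then obtain a b where ab: "[Suc i..<Suc j] @ [Suc k..<Suc l] = [Suc a..<Suc b]"
      unfolding factors_W by (auto simp del: upt_Suc)
    have len: "j - i + (l - k) = b - a"
      using arg_cong[OF ab, of length] by (simp del: upt_Suc)
    \<comment> \<open>Two entries of the interval \<open>ab\<close> decide the matter: position 0
      gives its start, and position \<open>j - i\<close> is the first letter of the second
      block.\<close>
    have "Suc i = Suc a"
      using arg_cong[OF ab, of "\<lambda>xs. xs ! 0"] that len by (simp add: nth_append del: upt_Suc)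
    moreover have "Suc k = Suc a + (j - i)"
      using arg_cong[OF ab, of "\<lambda>xs. xs ! (j - i)"] that len by (simp add: nth_append del: upt_Suc)
    ultimately show "j = k" using that by simp
  next
    assume "j = k"
    then have "[Suc i..<Suc j] @ [Suc k..<Suc l] = [Suc i..<Suc l]"
      using that upt_add_eq_append[of "Suc i" "Suc j" "l - j"] by (simp del: upt_Suc)
    then show "[Suc i..<Suc j] @ [Suc k..<Suc l] \<in> factors W"
      using that \<open>j = k\<close> unfolding factors_W by (force simp del: upt_Suc)
  qed
  have concat: "[Suc i..<Suc j] @ [Suc j..<Suc l] = [Suc i..<Suc l]" if "i < j" "j < l" for i j l
    using that upt_add_eq_append[of "Suc i" "Suc j" "l - j"] by (simp del: upt_Suc)
  have carrier: "carrier (S_alg W) = insert None (Some ` ?g ` {(i, j). i < j})"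
    by (simp only: S_alg_def factors_W alg.simps)
  have mult: "word_mult W (?h x) (?h y) = ?h (interval_mult x y)"
    if "x \<in> carrier A_inf" "y \<in> carrier A_inf" for x y
    using that append concat
    by (auto simp: A_inf_def word_mult_def interval_mult_def simp del: upt_Suc)
  have inj: "inj_on ?h (carrier A_inf)"
    by (auto simp: inj_on_def A_inf_def upt_eq_upt_iff simp del: upt_Suc)
  have "?h ` carrier A_inf = carrier (S_alg W)"
    unfolding carrier by (simp add: A_inf_def image_image del: upt_Suc)
  with inj have bij: "bij_betw ?h (carrier A_inf) (carrier (S_alg W))"
    by (simp add: bij_betw_def)
  have "add (S_alg W) (?h x) (?h y) = ?h (add A_inf x y)"
    if "x \<in> carrier A_inf" "y \<in> carrier A_inf" for x y
    using inj_on_eq_iff[OF inj that] by (simp add: A_inf_def S_alg_def flat_add_def)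
  moreover have "mult (S_alg W) (?h x) (?h y) = ?h (mult A_inf x y)"
    if "x \<in> carrier A_inf" "y \<in> carrier A_inf" for x y
    using mult[OF that] by (simp add: A_inf_def S_alg_def)
  ultimately have "?h \<in> hom A_inf (S_alg W)"
    unfolding hom_def using bij_betw_imp_surj_on[OF bij] by simp
  then have "holds A_inf s t \<longleftrightarrow> holds (S_alg W) s t"
    using holds_iso[OF algebra_A_inf _ bij] by blast
  also have "\<dots> \<longleftrightarrow> (\<forall>w\<in>W. holds (S_alg {w}) s t)"
    by (rule holds_S_alg_iff)
  also have "\<dots> \<longleftrightarrow> (\<forall>m. holds (A_alg m) s t)"
    by (simp add: W_def A_alg_def del: upt_Suc)
  finally show ?thesis .
qed

theorem mainTheorem2:
  fixes W :: "'x list set"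
  assumes "W \<noteq> {}"
    and "\<forall>w\<in>W. w \<noteq> [] \<and> distinct w"
  shows "(Var (S_alg W) :: 'b alg set) =
    (if bdd_above (length ` W) then Var (A_alg (Max (length ` W))) else Var A_inf)"
proof -
  \<comment> \<open>From here on only the set of lengths of words in \<open>W\<close>
    matters.\<close>
  have S: "holds (S_alg W) s t \<longleftrightarrow> (\<forall>w\<in>W. holds (A_alg (length w)) s t)" for s t :: "nat tm"
    using assms(2) by (subst holds_S_alg_iff) (simp add: holds_S_alg_distinct)
  show ?thesis
  proof (cases "bdd_above (length ` W)")
    case True
    then have fin: "finite (length ` W)" by (simp add: bdd_above_nat)
    \<comment> \<open>The maximum is attained, so its algebra is among those in \<open>S\<close>; by
      monotonicity its identities hold in all the others.\<close>
    have "Max (length ` W) \<in> length ` W" using fin assms(1) by (intro Max_in) auto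
    then have "holds (S_alg W) s t \<longleftrightarrow> holds (A_alg (Max (length ` W))) s t" for s t :: "nat tm"
      unfolding S using fin by (auto intro: holds_A_alg_mono[OF Max_ge])
    then have "(Var (S_alg W) :: 'b alg set) = Var (A_alg (Max (length ` W)))"
      by (intro Var_eqI) (simp_all add: A_alg_def algebra_S_alg del: upt_Suc)
    with True show ?thesis by simp
  next
    case False
    \<comment> \<open>The lengths are cofinal in the natural numbers, so by monotonicity the
      algebras in \<open>S\<close> have the same common identities as all
      \<open>A_alg m\<close>.\<close>
    then have "\<exists>w\<in>W. m \<le> length w" for m
      unfolding bdd_above_def by (auto simp: not_le dest!: spec[of _ m] intro: less_imp_le)
    then have "holds (S_alg W) s t \<longleftrightarrow> holds A_inf s t" for s t :: "nat tm"
      unfolding S holds_A_inf_iff by (meson holds_A_alg_mono)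
    then have "(Var (S_alg W) :: 'b alg set) = Var A_inf"
      by (intro Var_eqI) (simp_all add: algebra_A_inf algebra_S_alg)
    with False show ?thesis by simp
  qed
qed

end
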